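(* For all integers $n \geq 3$, we have $$\frac{3}{16}(n-3) \;\leq\; u(C_{n}) \;\leq\; \frac{n}{4},$$ where $C_n$ denotes the cycle on $n$ vertices.
   Context: Graphs are finite and simple. The Toucher-Isolator game on a graph $G=(V(G),E(G))$: two players, Toucher and Isolator, alternately claim previously unclaimed edges of $G$, one edge per move, with Toucher making the first move, until all edges are claimed. A vertex is touched if it is incident to at least one edge claimed by Toucher, and untouched otherwise (i.e. all of its incident edges have been claimed by Isolator). Toucher aims to minimise, and Isolator to maximise, the number of untouched vertices at the end of the game. $u(G)$ denotes the number of untouched vertices at the end of the game when both players play optimally (the minimax value of this game). *)

theory Defs
  imports Complex_Main
begin

text \<open>A graph is a pair of a vertex set and a set of edges, where an edge is the two-element
  set of its end points.\<close>

type_synonym 'a graph = "'a set \<times> 'a set set"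

definition verts :: "'a graph \<Rightarrow> 'a set" where
  "verts G = fst G"

definition edges :: "'a graph \<Rightarrow> 'a set set" where
  "edges G = snd G"

definition finite_simple_graph :: "'a graph \<Rightarrow> bool" where
  "finite_simple_graph G \<longleftrightarrow>
     finite (verts G) \<and> (\<forall>e\<in>edges G. e \<subseteq> verts G \<and> card e = 2)"

datatype player = Toucher | Isolator

text \<open>The vertices that are untouched once \<open>T\<close> is the set of edges claimed by Toucher.\<close>

definition untouched :: "'a graph \<Rightarrow> 'a set set \<Rightarrow> 'a set" where
  "untouched G T = {v \<in> verts G. \<forall>e\<in>T. v \<notin> e}"

text \<open>\<open>game_value G p T U\<close> is the number of untouched vertices at the end under optimal play from
  the position with \<open>p\<close> to move, Toucher owning the edges in \<open>T\<close>, and \<open>U\<close> being the set of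
  unclaimed edges (Isolator owns the rest). The value for infinite \<open>U\<close> is a dummy; it only
  makes the recursion total.\<close>

function game_value :: "'a graph \<Rightarrow> player \<Rightarrow> 'a set set \<Rightarrow> 'a set set \<Rightarrow> nat" where
  "game_value G p T U =
     (if infinite U then 0
      else if U = {} then card (untouched G T)
      else case p of
          Toucher \<Rightarrow> Min ((\<lambda>e. game_value G Isolator (insert e T) (U - {e})) ` U)
        | Isolator \<Rightarrow> Max ((\<lambda>e. game_value G Toucher T (U - {e})) ` U))"
  by pat_completeness auto
termination
  by (relation "measure (\<lambda>(G, p, T, U). card U)") (auto simp: card_gt_0_iff)

declare game_value.simps [simp del]

definition u :: "'a graph \<Rightarrow> nat" where
  "u G = game_value G Toucher {} (edges G)"

text \<open>This is the cycle on \<open>n\<close> vertices only for \<open>n \<ge> 3\<close>.\<close>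

definition cycle_graph :: "nat \<Rightarrow> nat graph" where
  "cycle_graph n = ({..<n}, (\<lambda>i. {i, (i + 1) mod n}) ` {..<n})"

lemma finite_simple_graph_cycle:
  assumes "n \<ge> 3"
  shows "finite_simple_graph (cycle_graph n)"
proof -
  have "i \<noteq> (i + 1) mod n" if "i < n" for i
    using that assms by (cases "i + 1 = n") auto
  then show ?thesis
    using assms by (auto simp: finite_simple_graph_def cycle_graph_def verts_def edges_def card_2_iff)
qed

end

theory Submission
  imports Defs
begin

text \<open>Both bounds come from a potential: a number attached to each position that equals the number of
untouched vertices (up to scaling) when the game is over, and that one of the players can keep from
moving in the wrong direction.

For the upper bound the potential is the expected number of untouched vertices if the free edges
were distributed by fair coin tosses. It starts at \<open>n/4\<close>. The edge that Toucher claims lowers it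
by the stake of that edge, the edge that Isolator claims next raises it by at most its stake before
Toucher's move. If Toucher always claims an edge of highest stake, the potential never increases
over a round (\<open>game_value_le_expectation\<close>). This works for every graph.

For the lower bound the claimed edges cut the cycle into gaps of consecutive free edges. Only the
length of a gap and the owners of the two claimed edges around it matter, so a position is a
sum of gaps, and an untouched vertex is a gap of length \<open>0\<close> between two Isolator edges. Each gap
gets a worth, in sixteenths of a vertex, and a heat such that

\<^item> a Toucher move inside a gap destroys at most its heat (\<open>Toucher_move_loss\<close>);
\<^item> some Isolator move inside a gap gains at least its heat and leaves no hotter gap behind
  (\<open>Isolator_move_gain\<close>).

Isolator always plays this move in a hottest gap. Whatever Toucher does next, here or elsewhere,
destroys no more than Isolator has just gained, so the total worth does not decrease from one turn
of Isolator to the next (\<open>hottest_gap_move\<close>). After Toucher's first move there is a single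
gap of \<open>n - 1\<close> edges between Toucher edges (the same edge on both sides), worth
\<open>3 (n - 1) - 6 = 3 (n - 3)\<close> sixteenths.\<close>

section \<open>Unfolding the minimax value\<close>

lemma game_value_final: "game_value G p T {} = card (untouched G T)"
  by (simp add: game_value.simps)

lemma game_value_le_Toucher_move:
  assumes "finite U" "e \<in> U"
  shows "game_value G Toucher T U \<le> game_value G Isolator (insert e T) (U - {e})"
  using assms by (subst game_value.simps) (auto intro: Min_le)

lemma game_value_ge_Isolator_move:
  assumes "finite U" "e \<in> U"
  shows "game_value G Toucher T (U - {e}) \<le> game_value G Isolator T U"
  using assms by (subst (2) game_value.simps) (auto intro: Max_ge)

lemma Toucher_has_optimal_move:
  assumes "finite U" "U \<noteq> {}"
  obtains e where "e \<in> U" "game_value G Toucher T U = game_value G Isolator (insert e T) (U - {e})"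
proof -
  let ?f = "\<lambda>e. game_value G Isolator (insert e T) (U - {e})"
  have "game_value G Toucher T U = Min (?f ` U)"
    using assms by (subst game_value.simps) auto
  moreover have "Min (?f ` U) \<in> ?f ` U"
    using assms by (intro Min_in) auto
  ultimately show thesis
    using that by auto
qed

lemma Isolator_has_optimal_move:
  assumes "finite U" "U \<noteq> {}"
  obtains e where "e \<in> U" "game_value G Isolator T U = game_value G Toucher T (U - {e})"
proof -
  let ?f = "\<lambda>e. game_value G Toucher T (U - {e})"
  have "game_value G Isolator T U = Max (?f ` U)"
    using assms by (subst game_value.simps) auto
  moreover have "Max (?f ` U) \<in> ?f ` U"
    using assms by (intro Max_in) auto
  ultimately show thesis
    using that by auto
qed

section \<open>Upper bound: Toucher minimises the random expectation\<close>

definition free_degree :: "'a set set \<Rightarrow> 'a \<Rightarrow> nat" where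
  "free_degree U v = card {e \<in> U. v \<in> e}"

text \<open>The probability that an untouched vertex stays so if each free edge goes to either player with
probability one half is \<open>(1/2)\<close> to the power of its free degree. Touched vertices contribute nothing.\<close>

definition expectation :: "'a graph \<Rightarrow> 'a set set \<Rightarrow> 'a set set \<Rightarrow> real" where
  "expectation G T U = (\<Sum>v\<in>untouched G T. (1/2) ^ free_degree U v)"

text \<open>The part of the expectation that sits on the end points of an edge: Toucher destroys it by claiming
the edge, Isolator doubles it.\<close>

definition stake :: "'a graph \<Rightarrow> 'a set set \<Rightarrow> 'a set set \<Rightarrow> 'a set \<Rightarrow> real" where
  "stake G T U e = (\<Sum>v\<in>untouched G T \<inter> e. (1/2) ^ free_degree U v)"

lemma finite_untouched: "finite (verts G) \<Longrightarrow> finite (untouched G T)"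
  by (simp add: untouched_def)

lemma untouched_insert: "untouched G (insert e T) = untouched G T - e"
  by (auto simp: untouched_def)

lemma expectation_split:
  assumes "finite (verts G)"
  shows "expectation G T U =
    (\<Sum>v\<in>untouched G T - e. (1/2) ^ free_degree U v) + stake G T U e"
  unfolding expectation_def stake_def
  by (subst sum.Int_Diff[OF finite_untouched[OF assms], of _ _ e]) simp

lemma free_degree_remove_other:
  assumes "v \<notin> e"
  shows "free_degree (U - {e}) v = free_degree U v"
proof -
  have "{e' \<in> U - {e}. v \<in> e'} = {e' \<in> U. v \<in> e'}"
    using assms by auto
  then show ?thesis
    unfolding free_degree_def by (rule arg_cong)
qed

lemma free_degree_remove_incident:
  assumes "finite U" "e \<in> U" "v \<in> e"
  shows "free_degree U v = Suc (free_degree (U - {e}) v)"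
proof -
  have "{e' \<in> U. v \<in> e'} = insert e {e' \<in> U - {e}. v \<in> e'}"
    using assms by auto
  moreover have "finite {e' \<in> U - {e}. v \<in> e'}"
    using assms by simp
  ultimately show ?thesis
    unfolding free_degree_def by simp
qed

lemma expectation_Toucher_move:
  assumes "finite (verts G)"
  shows "expectation G (insert e T) (U - {e}) = expectation G T U - stake G T U e"
  unfolding expectation_split[OF assms, of T U e]
  by (simp add: expectation_def untouched_insert free_degree_remove_other)

lemma expectation_Isolator_move:
  assumes "finite (verts G)" "finite U" "e \<in> U"
  shows "expectation G T (U - {e}) = expectation G T U + stake G T U e"
proof -
  have "stake G T (U - {e}) e = 2 * stake G T U e"
    unfolding stake_def sum_distrib_left
    using free_degree_remove_incident[OF assms(2,3)] by (intro sum.cong) auto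
  then show ?thesis
    using expectation_split[OF assms(1), of T "U - {e}" e] expectation_split[OF assms(1), of T U e]
    by (simp add: free_degree_remove_other)
qed

text \<open>Stakes can only drop: end points shared with Toucher's edge are now touched, and the free degrees
of the other vertices have not changed.\<close>

lemma stake_after_Toucher_move:
  assumes "finite (verts G)"
  shows "stake G (insert e T) (U - {e}) f \<le> stake G T U f"
proof -
  have "stake G (insert e T) (U - {e}) f =
      (\<Sum>v\<in>(untouched G T - e) \<inter> f. (1/2) ^ free_degree U v)"
    unfolding stake_def untouched_insert
    by (intro sum.cong refl) (auto simp: free_degree_remove_other)
  also have "\<dots> \<le> stake G T U f"
    unfolding stake_def using finite_untouched[OF assms] by (intro sum_mono2) auto
  finally show ?thesis .
qed

text \<open>Claiming the edge of highest stake costs Isolator at least as much as any reply can win back.\<close>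

lemma game_value_le_expectation:
  assumes "finite (verts G)" "finite U"
  shows "real (game_value G Toucher T U) \<le> expectation G T U"
  using assms(2)
proof (induction "card U" arbitrary: T U rule: less_induct)
  case less
  show ?case
  proof (cases "U = {}")
    case True
    then show ?thesis
      by (simp add: game_value_final expectation_def free_degree_def)
  next
    case False
    then have "Max (stake G T U ` U) \<in> stake G T U ` U"
      using less.prems by (intro Max_in) auto
    then obtain e where e: "e \<in> U" "stake G T U e = Max (stake G T U ` U)"
      by auto
    then have e_max: "stake G T U f \<le> stake G T U e" if "f \<in> U" for f
      using that less.prems by simp
    let ?T = "insert e T" and ?U = "U - {e}"
    have "real (game_value G Isolator ?T ?U) \<le> expectation G T U"
    proof (cases "?U = {}")
      case True
      have "stake G T U e \<ge> 0"
        by (simp add: stake_def sum_nonneg)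
      moreover have "real (card (untouched G ?T)) = expectation G ?T ?U"
        unfolding True by (simp add: expectation_def free_degree_def)
      ultimately show ?thesis
        using expectation_Toucher_move[OF assms(1), of e T U]
        unfolding True by (simp add: game_value_final)
    next
      case False
      then obtain f where f: "f \<in> ?U"
        and opt: "game_value G Isolator ?T ?U = game_value G Toucher ?T (?U - {f})"
        using Isolator_has_optimal_move less.prems by (metis finite_Diff)
      have "card (?U - {f}) < card U"
        using less.prems e f by (intro psubset_card_mono) auto
      then have "real (game_value G Isolator ?T ?U) \<le> expectation G ?T (?U - {f})"
        using less.hyps less.prems opt by simp
      also have "\<dots> = expectation G T U - stake G T U e + stake G ?T ?U f"
        using expectation_Isolator_move[OF assms(1) _ f, of ?T]
          expectation_Toucher_move[OF assms(1), of e T U] less.prems by simp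
      also have "\<dots> \<le> expectation G T U"
        using e_max[of f] f stake_after_Toucher_move[OF assms(1), of e T U f] by simp
      finally show ?thesis .
    qed
    then show ?thesis
      using game_value_le_Toucher_move[OF less.prems e(1), of G T] by linarith
  qed
qed

section \<open>Gaps between claimed edges\<close>

type_synonym gap = "player \<times> player \<times> nat"

text \<open>A row of consecutive edges is a word over \<open>player option\<close>, with \<open>None\<close> for a free edge. The first
two arguments of the scan are the owner of the last claimed edge to the left and the number of free
edges passed since. Adjacent claimed edges yield a gap of length \<open>0\<close>, so that untouched vertices are
recorded too. Free edges after the last claimed edge are lost, which is why the facts below ask for
words that end in a claimed edge.\<close>

fun gaps :: "player \<Rightarrow> nat \<Rightarrow> player option list \<Rightarrow> gap list" where
  "gaps a k [] = []"
| "gaps a k (None # w) = gaps a (Suc k) w"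
| "gaps a k (Some b # w) = (a, b, k) # gaps b 0 w"

definition gap_move :: "player \<Rightarrow> gap list \<Rightarrow> gap list \<Rightarrow> bool" where
  "gap_move p gs gs' \<longleftrightarrow> (\<exists>A B a b l r.
     gs = A @ (a, b, l + 1 + r) # B \<and> gs' = A @ (a, p, l) # (p, b, r) # B)"

text \<open>The gap that is open when the scan of \<open>w\<close> starts is the only one affected by what lies to the left
of \<open>w\<close>. The order of quantifiers says that its right end and the remaining gaps depend on \<open>w\<close> alone.\<close>

lemma gaps_first:
  assumes "w \<noteq> []" "last w \<noteq> None"
  shows "\<exists>b r B. \<forall>a k. gaps a k w = (a, b, k + r) # B"
  using assms
proof (induction w)
  case (Cons c w)
  show ?case
  proof (cases c)
    case None
    then obtain b r B where "\<And>a k. gaps a k w = (a, b, k + r) # B"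
      using Cons by (metis last.simps)
    then have "\<forall>a k. gaps a k (c # w) = (a, b, k + Suc r) # B"
      using None by simp
    then show ?thesis
      by blast
  next
    case (Some b)
    then have "\<forall>a k. gaps a k (c # w) = (a, b, k + 0) # gaps b 0 w"
      by simp
    then show ?thesis
      by blast
  qed
qed simp

lemma gap_move_Cons: "gap_move p gs gs' \<Longrightarrow> gap_move p (g # gs) (g # gs')"
  unfolding gap_move_def by (metis append_Cons)

lemma gap_move_of_claim:
  assumes "last w \<noteq> None" "i < length w" "w ! i = None"
  shows "gap_move p (gaps a k w) (gaps a k (w[i := Some p]))"
  using assms
proof (induction w arbitrary: a k i)
  case (Cons c w)
  show ?case
  proof (cases i)
    case 0
    with Cons.prems have c: "c = None" and w: "w \<noteq> []" "last w \<noteq> None"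
      by (auto split: if_splits)
    obtain b r B where B: "\<And>a k. gaps a k w = (a, b, k + r) # B"
      using gaps_first[OF w] by blast
    have "gaps a k (c # w) = [] @ (a, b, k + 1 + r) # B"
      using c B by simp
    moreover have "gaps a k ((c # w)[i := Some p]) = [] @ (a, p, k) # (p, b, r) # B"
      using 0 B by simp
    ultimately show ?thesis
      unfolding gap_move_def by blast
  next
    case (Suc m)
    with Cons.prems have "last w \<noteq> None" "m < length w" "w ! m = None"
      by (auto split: if_splits)
    from Cons.IH[OF this] show ?thesis
      using Suc by (cases c) (auto intro: gap_move_Cons)
  qed
qed simp

text \<open>The converse of \<open>gap_move_of_claim\<close>: every move on gaps is realised by claiming an edge of the word.
The condition on \<open>l\<close> excludes the \<open>k\<close> free edges of the first gap that precede the word.\<close>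

lemma claim_in_gap:
  assumes "last w \<noteq> None" "gaps a k w = A @ (a', b, l + 1 + r) # B" "A = [] \<Longrightarrow> k \<le> l"
  shows "\<exists>i<length w. w ! i = None \<and>
    gaps a k (w[i := Some p]) = A @ (a', p, l) # (p, b, r) # B"
  using assms
proof (induction w arbitrary: a k A)
  case (Cons c w)
  show ?case
  proof (cases c)
    case None
    show ?thesis
    proof (cases "A = [] \<and> l = k")
      case True
      have "gaps a (Suc k) w = (a', b, Suc (k + r)) # B"
        using Cons.prems(2) None True by simp
      moreover from this have "w \<noteq> []"
        by auto
      with Cons.prems(1) obtain b' r' B' where "\<And>a k. gaps a k w = (a, b', k + r') # B'"
        using gaps_first by (metis last.simps)
      ultimately have "gaps a k (Some p # w) = (a', p, k) # (p, b, r) # B"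
        by simp
      then show ?thesis
        using None True by (intro exI[of _ 0]) simp
    next
      case False
      with Cons.prems None have "last w \<noteq> None" "gaps a (Suc k) w = A @ (a', b, l + 1 + r) # B"
        "A = [] \<Longrightarrow> Suc k \<le> l"
        by (auto split: if_splits)
      from Cons.IH[OF this] obtain i where "i < length w" "w ! i = None"
        "gaps a (Suc k) (w[i := Some p]) = A @ (a', p, l) # (p, b, r) # B"
        by blast
      with None show ?thesis
        by (intro exI[of _ "Suc i"]) simp
    qed
  next
    case (Some d)
    show ?thesis
    proof (cases A)
      case Nil
      with Cons.prems Some show ?thesis
        by simp
    next
      case (Cons g A')
      with Cons.prems Some have g: "g = (a, d, k)" and "last w \<noteq> None" "gaps d 0 w = A' @ (a', b, l + 1 + r) # B"
        by (auto split: if_splits)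
      from Cons.IH[OF this(2,3)] obtain i where "i < length w" "w ! i = None"
        "gaps d 0 (w[i := Some p]) = A' @ (a', p, l) # (p, b, r) # B"
        by blast
      with Some Cons g show ?thesis
        by (intro exI[of _ "Suc i"]) simp
    qed
  qed
qed simp

section \<open>The worth and the heat of a gap\<close>

text \<open>The unit is one sixteenth of a vertex. The bound to be proved dictates the slope of \<open>3\<close> per edge. In
a long gap next to one Isolator edge, Isolator extends that edge, which isolates a vertex and
shortens the gap by one: a gain of \<open>16 - 3 = 13\<close>. If Toucher blocks instead, the gap shrinks by one and
loses its Isolator side. The constants \<open>4\<close> and \<open>-6\<close> make this loss \<open>13\<close> as well. With the constant
\<open>-6\<close>, splitting a gap between Toucher edges costs at most \<open>9\<close>. The values \<open>8\<close> and
\<open>12\<close> for gaps of lengths \<open>1\<close> and \<open>2\<close> lie above the line \<open>3 k + 4\<close> and balance gain and loss at \<open>8\<close>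
and \<open>12\<close>. A gap of positive length between two Isolator edges does not arise from Isolator's
strategy, and its value is a dummy.\<close>

fun worth :: "gap \<Rightarrow> int" where
  "worth (Toucher, Toucher, k) = max 0 (3 * int k - 6)"
| "worth (Isolator, Isolator, k) = (if k = 0 then 16 else 0)"
| "worth (_, _, k) =
     (if k = 0 then 0 else if k = 1 then 8 else if k = 2 then 12 else 3 * int k + 4)"

text \<open>A threshold between what Toucher can destroy and what Isolator can gain with one move in the gap.
All moves of Toucher cost at most \<open>13\<close>, so \<open>13\<close> is as hot as a gap needs to be even where Isolator
can gain more.\<close>

fun heat :: "gap \<Rightarrow> int" where
  "heat (Toucher, Toucher, k) = (if k \<le> 1 then 0 else if k = 2 then 8 else 13)"
| "heat (Isolator, Isolator, k) = 0"
| "heat (_, _, k) = (if k = 0 then 0 else if k = 1 then 8 else if k = 2 then 12 else 13)"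

text \<open>Isolator enters a gap between Toucher edges once and afterwards only extends own edges. Hence no
free edges are ever enclosed between two Isolator edges.\<close>

fun not_enclosed :: "gap \<Rightarrow> bool" where
  "not_enclosed (a, b, k) \<longleftrightarrow> (a = Isolator \<and> b = Isolator \<longrightarrow> k = 0)"

lemma heat_nonneg: "0 \<le> heat g"
  by (cases g rule: heat.cases) auto

lemma Toucher_move_loss:
  assumes "not_enclosed (a, b, l + 1 + r)"
  shows "worth (a, b, l + 1 + r) - heat (a, b, l + 1 + r)
    \<le> worth (a, Toucher, l) + worth (Toucher, b, r)"
  using assms by (cases a; cases b) auto

text \<open>Next to an Isolator edge, the move extends it. Between Toucher edges, a long gap is entered at
distance two from one end, so that the short side is worth \<open>12\<close>, which is \<open>2\<close> more than the
line \<open>3 k + 4\<close> gives. Any two sides on that line would gain only \<open>11\<close>, too little to make up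
for Toucher's blocking move of \<open>13\<close>.\<close>

lemma Isolator_move_gain:
  assumes "not_enclosed (a, b, k)" "0 < k"
  shows "\<exists>l r. k = l + 1 + r \<and>
    worth (a, b, k) + heat (a, b, k) \<le> worth (a, Isolator, l) + worth (Isolator, b, r) \<and>
    heat (a, Isolator, l) \<le> heat (a, b, k) \<and> heat (Isolator, b, r) \<le> heat (a, b, k) \<and>
    not_enclosed (a, Isolator, l) \<and> not_enclosed (Isolator, b, r)"
proof (cases a; cases b)
  assume ab: "a = Toucher" "b = Toucher"
  \<comment> \<open>Length 3 is entered in the middle: two sides of length 1 are worth 16 in total.\<close>
  define l where "l = (if k \<ge> 4 then 2 else if k = 3 then 1 else 0 :: nat)"
  have "k = 1 \<or> k = 2 \<or> k = 3 \<or> k \<ge> 4"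
    using assms by linarith
  then show ?thesis
    using ab assms by (intro exI[of _ l] exI[of _ "k - 1 - l"]) (auto simp: l_def)
next
  assume ab: "a = Toucher" "b = Isolator"
  then show ?thesis
    using assms by (intro exI[of _ "k - 1"] exI[of _ 0]) auto
next
  assume ab: "a = Isolator" "b = Toucher"
  then show ?thesis
    using assms by (intro exI[of _ 0] exI[of _ "k - 1"]) auto
qed (use assms in auto)

abbreviation total_worth :: "gap list \<Rightarrow> int" where
  "total_worth gs \<equiv> sum_list (map worth gs)"

lemma total_worth_Toucher_move:
  assumes "gap_move Toucher gs gs'" "\<forall>g\<in>set gs. not_enclosed g" "\<forall>g\<in>set gs. heat g \<le> h"
  shows "total_worth gs - h \<le> total_worth gs'" "\<forall>g\<in>set gs'. not_enclosed g"
proof -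
  obtain A B a b l r where gs: "gs = A @ (a, b, l + 1 + r) # B"
    "gs' = A @ (a, Toucher, l) # (Toucher, b, r) # B"
    using assms(1) unfolding gap_move_def by blast
  have "worth (a, b, l + 1 + r) - heat (a, b, l + 1 + r)
      \<le> worth (a, Toucher, l) + worth (Toucher, b, r)"
    using assms(2) gs by (intro Toucher_move_loss) auto
  moreover have "heat (a, b, l + 1 + r) \<le> h"
    using assms(3) gs by simp
  ultimately show "total_worth gs - h \<le> total_worth gs'"
    unfolding gs by simp
  show "\<forall>g\<in>set gs'. not_enclosed g"
    using assms(2) gs by auto
qed

text \<open>Isolator's strategy. After the move all gaps have heat at most \<open>h\<close>, the heat of the gap just played
in. So Toucher's reply takes back at most the \<open>h\<close> that Isolator has gained.\<close>

lemma hottest_gap_move: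
  assumes "\<forall>g\<in>set gs. not_enclosed g" "(a0, b0, k0) \<in> set gs" "0 < k0"
  obtains A B a b l r gs' where "gs = A @ (a, b, l + 1 + r) # B"
    "gs' = A @ (a, Isolator, l) # (Isolator, b, r) # B"
    "total_worth gs \<le> total_worth gs'" "\<forall>g\<in>set gs'. not_enclosed g"
    "\<And>gs''. gap_move Toucher gs' gs'' \<Longrightarrow>
       total_worth gs \<le> total_worth gs'' \<and> (\<forall>g\<in>set gs''. not_enclosed g)"
proof -
  let ?S = "{g \<in> set gs. 0 < snd (snd g)}"
  have "Max (heat ` ?S) \<in> heat ` ?S"
    using assms by (intro Max_in) auto
  then obtain a b k where abk: "(a, b, k) \<in> set gs" "0 < k" "heat (a, b, k) = Max (heat ` ?S)"
    by auto
  define h where "h = heat (a, b, k)"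
  have hot: "heat g \<le> h" if "g \<in> set gs" for g
  proof (cases "0 < snd (snd g)")
    case True
    then show ?thesis
      using that abk by (auto simp: h_def)
  next
    case False
    then have "heat g = 0"
      by (cases g rule: heat.cases) auto
    then show ?thesis
      using heat_nonneg by (simp add: h_def)
  qed
  obtain l r where lr: "k = l + 1 + r"
    "worth (a, b, k) + h \<le> worth (a, Isolator, l) + worth (Isolator, b, r)"
    "heat (a, Isolator, l) \<le> h" "heat (Isolator, b, r) \<le> h"
    "not_enclosed (a, Isolator, l)" "not_enclosed (Isolator, b, r)"
    using Isolator_move_gain[of a b k] assms(1) abk unfolding h_def by blast
  obtain A B where gs: "gs = A @ (a, b, l + 1 + r) # B"
    using abk(1) lr(1) by (meson split_list)
  define gs' where "gs' = A @ (a, Isolator, l) # (Isolator, b, r) # B"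
  have gain: "total_worth gs + h \<le> total_worth gs'"
    using lr(1,2) unfolding gs gs'_def by simp
  have valid: "\<forall>g\<in>set gs'. not_enclosed g"
    using assms(1) lr(5,6) unfolding gs gs'_def by auto
  have cool: "\<forall>g\<in>set gs'. heat g \<le> h"
    using hot lr(3,4) unfolding gs gs'_def by auto
  show thesis
  proof (rule that[OF gs gs'_def _ valid])
    show "total_worth gs \<le> total_worth gs'"
      using gain heat_nonneg[of "(a, b, k)"] by (simp add: h_def)
    show "total_worth gs \<le> total_worth gs'' \<and> (\<forall>g\<in>set gs''. not_enclosed g)"
      if "gap_move Toucher gs' gs''" for gs''
      using total_worth_Toucher_move[OF that valid cool] gain by simp
  qed
qed

section \<open>The cycle as a word\<close>

definition cycle_edge :: "nat \<Rightarrow> nat \<Rightarrow> nat set" where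
  "cycle_edge n i = {i mod n, Suc i mod n}"

definition cell :: "'a set set \<Rightarrow> 'a set set \<Rightarrow> 'a set \<Rightarrow> player option" where
  "cell T U e = (if e \<in> U then None else if e \<in> T then Some Toucher else Some Isolator)"

text \<open>The cycle is cut open at its edge number \<open>j\<close>, in applications one that Toucher owns. The word lists
the edges after it and ends with edge \<open>j\<close> itself, one full turn later. Scanning it from an
imagined Toucher edge on the left therefore sees every pair of adjacent edges of the cycle once.\<close>

definition word :: "nat \<Rightarrow> nat \<Rightarrow> nat set set \<Rightarrow> nat set set \<Rightarrow> player option list" where
  "word n j T U = map (\<lambda>i. cell T U (cycle_edge n (j + Suc i))) [0..<n]"

lemma cycle_edge_mod: "cycle_edge n (i mod n) = cycle_edge n i"
  by (simp add: cycle_edge_def mod_Suc_eq)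

lemma edges_cycle_graph: "edges (cycle_graph n) = cycle_edge n ` {..<n}"
  unfolding edges_def cycle_graph_def cycle_edge_def by (auto simp: image_iff)

lemma bij_betw_shift_mod:
  fixes n c :: nat
  shows "bij_betw (\<lambda>i. (c + i) mod n) {..<n} {..<n}"
proof -
  have "inj_on (\<lambda>i. (c + i) mod n) {..<n}"
  proof (rule linorder_inj_onI)
    fix x y assume "x < y" and xy: "x \<in> {..<n}" "y \<in> {..<n}"
    show "(c + x) mod n \<noteq> (c + y) mod n"
    proof
      assume "(c + x) mod n = (c + y) mod n"
      then have "n dvd (c + y) - (c + x)"
        using \<open>x < y\<close> by (metis mod_eq_dvd_iff_nat add_left_mono less_imp_le)
      with \<open>x < y\<close> xy show False
        by (auto dest: dvd_imp_le)
    qed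
  qed auto
  moreover have "(\<lambda>i. (c + i) mod n) ` {..<n} \<subseteq> {..<n}"
    by auto
  ultimately show ?thesis
    by (simp add: bij_betw_def endo_inj_surj)
qed

lemma inj_on_cycle_edge:
  assumes "3 \<le> n"
  shows "inj_on (cycle_edge n) {..<n}"
proof (rule inj_onI)
  fix a b assume ab: "a \<in> {..<n}" "b \<in> {..<n}" "cycle_edge n a = cycle_edge n b"
  show "a = b"
  proof (rule ccontr)
    assume "a \<noteq> b"
    with ab have "a = Suc b mod n" "b = Suc a mod n"
      by (auto simp: cycle_edge_def doubleton_eq_iff)
    moreover have "Suc x mod n = Suc x \<or> Suc x mod n = 0 \<and> Suc x = n" if "x \<in> {..<n}" for x
      using that by (auto simp: mod_Suc)
    ultimately have "a = Suc b \<or> a = 0 \<and> Suc b = n" "b = Suc a \<or> b = 0 \<and> Suc a = n"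
      using ab(1,2) by metis+
    with assms show False
      by presburger
  qed
qed

lemma bij_betw_cycle_edge:
  assumes "3 \<le> n"
  shows "bij_betw (\<lambda>i. cycle_edge n (c + i)) {..<n} (edges (cycle_graph n))"
proof -
  have "bij_betw (cycle_edge n \<circ> (\<lambda>i. (c + i) mod n)) {..<n} (edges (cycle_graph n))"
    using bij_betw_shift_mod inj_on_cycle_edge[OF assms]
    by (intro bij_betw_trans[of _ _ "{..<n}"]) (auto simp: bij_betw_def edges_cycle_graph)
  then show ?thesis
    by (simp add: comp_def cycle_edge_mod)
qed

lemma length_word [simp]: "length (word n j T U) = n"
  by (simp add: word_def)

lemma nth_word: "i < n \<Longrightarrow> word n j T U ! i = cell T U (cycle_edge n (j + Suc i))"
  by (simp add: word_def)

lemma cycle_edge_position: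
  assumes "3 \<le> n" "e \<in> edges (cycle_graph n)"
  obtains i where "i < n" "e = cycle_edge n (j + Suc i)"
proof -
  have "e \<in> (\<lambda>i. cycle_edge n (Suc j + i)) ` {..<n}"
    using bij_betw_cycle_edge[OF assms(1), of "Suc j"] assms(2) by (simp add: bij_betw_def)
  then show thesis
    using that by auto
qed

lemma word_claim:
  assumes "3 \<le> n" "i < n" and e: "e = cycle_edge n (j + Suc i)" and "e \<notin> T"
  shows "word n j (insert e T) (U - {e}) = (word n j T U)[i := Some Toucher]"
    and "word n j T (U - {e}) = (word n j T U)[i := Some Isolator]"
proof -
  have "cycle_edge n (j + Suc m) = e \<longleftrightarrow> m = i" if "m < n" for m
    using bij_betw_cycle_edge[OF assms(1), of "Suc j"] that assms(2) e
    by (auto simp: bij_betw_def dest: inj_onD)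
  then show "word n j (insert e T) (U - {e}) = (word n j T U)[i := Some Toucher]"
    "word n j T (U - {e}) = (word n j T U)[i := Some Isolator]"
    using assms(2,4) e by (auto intro!: nth_equalityI simp: nth_word nth_list_update cell_def)
qed

lemma last_word:
  assumes "0 < n" "cycle_edge n j \<in> T" "T \<inter> U = {}"
  shows "last (word n j T U) = Some Toucher"
proof -
  have "cycle_edge n (j + n) = cycle_edge n j"
    by (metis cycle_edge_mod mod_add_self2)
  moreover have "last (word n j T U) = word n j T U ! (n - 1)"
    using assms(1) by (subst last_conv_nth) (auto simp: word_def)
  ultimately show ?thesis
    using assms by (auto simp: nth_word cell_def)
qed

section \<open>Lower bound: Isolator plays in the hottest gap\<close>

lemma total_worth_full:
  assumes "None \<notin> set w"
  shows "total_worth (gaps a 0 w) =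
    16 * int (card {i. i < length w \<and> (Some a # w) ! i = Some Isolator \<and> w ! i = Some Isolator})"
proof -
  have "total_worth (gaps a 0 w) =
      16 * int (length (filter (\<lambda>(x, y). x = Some Isolator \<and> y = Some Isolator) (zip (Some a # w) w)))"
    using assms
  proof (induction w arbitrary: a)
    case (Cons c w)
    then obtain b where c: "c = Some b"
      by (cases c) auto
    with Cons have "total_worth (gaps b 0 w) =
      16 * int (length (filter (\<lambda>(x, y). x = Some Isolator \<and> y = Some Isolator) (zip (Some b # w) w)))"
      by simp
    then show ?case
      using c by (cases a; cases b) auto
  qed simp
  also have "{i. i < length (zip (Some a # w) w) \<and>
      (case zip (Some a # w) w ! i of (x, y) \<Rightarrow> x = Some Isolator \<and> y = Some Isolator)} =
    {i. i < length w \<and> (Some a # w) ! i = Some Isolator \<and> w ! i = Some Isolator}"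
    by auto
  then have "length (filter (\<lambda>(x, y). x = Some Isolator \<and> y = Some Isolator) (zip (Some a # w) w)) =
    card {i. i < length w \<and> (Some a # w) ! i = Some Isolator \<and> w ! i = Some Isolator}"
    by (simp only: length_filter_conv_card)
  finally show ?thesis .
qed

text \<open>When no edge is free, the worth is \<open>16\<close> for every pair of adjacent Isolator edges, and the vertex
shared by such a pair is untouched because these are its only two edges.\<close>

lemma total_worth_le_untouched:
  assumes "3 \<le> n" "cycle_edge n j \<in> T" "T \<subseteq> edges (cycle_graph n)"
  shows "total_worth (gaps Toucher 0 (word n j T {})) \<le> 16 * int (card (untouched (cycle_graph n) T))"
proof -
  let ?w = "word n j T {}"
  let ?I = "{i. i < length ?w \<and> (Some Toucher # ?w) ! i = Some Isolator \<and> ?w ! i = Some Isolator}"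
  have "(Suc j + i) mod n \<in> untouched (cycle_graph n) T" if i: "i \<in> ?I" for i
  proof -
    have no_j: "cycle_edge n (j + i) \<notin> T" "cycle_edge n (j + Suc i) \<notin> T"
      using i by (cases i; auto simp: nth_word cell_def split: if_splits)+
    have "(Suc j + i) mod n \<notin> e" if "e \<in> T" for e
    proof
      assume v: "(Suc j + i) mod n \<in> e"
      obtain m where m: "m < n" "e = cycle_edge n m"
        using \<open>e \<in> T\<close> assms(3) by (auto simp: edges_cycle_graph)
      with v consider "m = (j + Suc i) mod n" | "Suc (j + i) mod n = Suc m mod n"
        by (auto simp: cycle_edge_def)
      then show False
      proof cases
        case 1
        then show False
          using m no_j(2) \<open>e \<in> T\<close> by (simp only: cycle_edge_mod)
      next
        case 2
        then have "(j + i) mod n = m"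
          using m(1) mod_Suc[of "j + i" n] mod_Suc[of m n] by (auto split: if_splits)
        then show False
          using m no_j(1) \<open>e \<in> T\<close> by (metis cycle_edge_mod)
      qed
    qed
    moreover have "(Suc j + i) mod n < n"
      using assms(1) by simp
    ultimately show ?thesis
      by (auto simp: untouched_def verts_def cycle_graph_def)
  qed
  moreover have "inj_on (\<lambda>i. (Suc j + i) mod n) ?I"
    using bij_betw_shift_mod[of "Suc j" n] by (auto simp: bij_betw_def intro: inj_on_subset)
  moreover have "finite (untouched (cycle_graph n) T)"
    by (simp add: untouched_def verts_def cycle_graph_def)
  ultimately have "card ?I \<le> card (untouched (cycle_graph n) T)"
    by (intro card_inj_on_le[of "\<lambda>i. (Suc j + i) mod n"]) auto
  moreover have "None \<notin> set ?w"
    by (auto simp: word_def cell_def)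
  ultimately show ?thesis
    using total_worth_full[of ?w Toucher] by linarith
qed

text \<open>Isolator, to move, can secure the total worth: play the hottest gap, let Toucher reply, and
continue by induction. If no edge is left for a reply, Isolator's move itself has not lowered
the worth.\<close>

lemma total_worth_le_game_value:
  assumes "3 \<le> n" "cycle_edge n j \<in> T" "T \<union> U \<subseteq> edges (cycle_graph n)" "T \<inter> U = {}"
    and "\<forall>g\<in>set (gaps Toucher 0 (word n j T U)). not_enclosed g"
  shows "total_worth (gaps Toucher 0 (word n j T U)) \<le>
    16 * int (game_value (cycle_graph n) Isolator T U)"
  using assms(2-)
proof (induction "card U" arbitrary: T U rule: less_induct)
  case less
  let ?G = "cycle_graph n" and ?gaps = "\<lambda>T U. gaps Toucher 0 (word n j T U)"
  have fin: "finite U"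
    using less.prems(2) by (auto simp: edges_cycle_graph dest: finite_subset)
  show ?case
  proof (cases "U = {}")
    case True
    then show ?thesis
      using total_worth_le_untouched[OF assms(1)] less.prems by (simp add: game_value_final)
  next
    case False
    have last: "last (word n j T U) \<noteq> None"
      using last_word[of n j T U] less.prems assms(1) by simp
    from False obtain e0 where e0: "e0 \<in> U"
      by blast
    with less.prems(2) obtain i0 where "i0 < n" "e0 = cycle_edge n (j + Suc i0)"
      using cycle_edge_position[OF assms(1)] by blast
    with e0 have "word n j T U ! i0 = None" "i0 < length (word n j T U)"
      by (auto simp: nth_word cell_def)
    from gap_move_of_claim[OF last this(2,1), of Isolator Toucher 0]
    obtain A0 B0 a0 b0 l0 r0 where "?gaps T U = A0 @ (a0, b0, l0 + 1 + r0) # B0"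
      unfolding gap_move_def by blast
    then have "(a0, b0, l0 + 1 + r0) \<in> set (?gaps T U)" "0 < l0 + 1 + r0"
      by simp_all
    then obtain A B a b l r gs' where gs: "?gaps T U = A @ (a, b, l + 1 + r) # B"
      and gs': "gs' = A @ (a, Isolator, l) # (Isolator, b, r) # B"
      and gain: "total_worth (?gaps T U) \<le> total_worth gs'"
      and valid: "\<forall>g\<in>set gs'. not_enclosed g"
      and reply: "\<And>gs''. gap_move Toucher gs' gs'' \<Longrightarrow>
        total_worth (?gaps T U) \<le> total_worth gs'' \<and> (\<forall>g\<in>set gs''. not_enclosed g)"
      by (rule hottest_gap_move[OF less.prems(4)]) (rule that)
    obtain i where i: "i < n" "word n j T U ! i = None"
      "gaps Toucher 0 ((word n j T U)[i := Some Isolator]) = gs'"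
      using claim_in_gap[OF last gs, of Isolator] gs' by auto
    define e where "e = cycle_edge n (j + Suc i)"
    have e: "e \<in> U" "e \<notin> T"
      using i less.prems(3) by (auto simp: nth_word cell_def e_def split: if_splits)
    let ?U = "U - {e}"
    have gaps_e: "?gaps T ?U = gs'"
      using word_claim(2)[OF assms(1) i(1) e_def e(2)] i(3) by simp
    have "total_worth (?gaps T U) \<le> 16 * int (game_value ?G Toucher T ?U)"
    proof (cases "?U = {}")
      case True
      have "total_worth (?gaps T ?U) \<le> 16 * int (card (untouched ?G T))"
        unfolding True using total_worth_le_untouched[OF assms(1)] less.prems by simp
      then show ?thesis
        using gain gaps_e unfolding True by (simp add: game_value_final)
    next
      case False
      then obtain f where f: "f \<in> ?U"
        and opt: "game_value ?G Toucher T ?U = game_value ?G Isolator (insert f T) (?U - {f})"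
        using Toucher_has_optimal_move fin by (metis finite_Diff)
      have fU: "f \<in> U" "f \<notin> T"
        using f less.prems(3) by auto
      obtain m where m: "m < n" "f = cycle_edge n (j + Suc m)"
        using cycle_edge_position[OF assms(1)] fU less.prems(2) by blast
      have "word n j T ?U ! m = None"
        using m f by (auto simp: nth_word cell_def)
      moreover have "last (word n j T ?U) \<noteq> None"
        using last_word[of n j T ?U] less.prems assms(1) by auto
      ultimately have "gap_move Toucher gs' (?gaps (insert f T) (?U - {f}))"
        using gap_move_of_claim[of "word n j T ?U" m Toucher Toucher 0] m(1) gaps_e
          word_claim(1)[OF assms(1) m fU(2), of ?U] by simp
      from reply[OF this] have "total_worth (?gaps T U) \<le> total_worth (?gaps (insert f T) (?U - {f}))"
        and "\<forall>g\<in>set (?gaps (insert f T) (?U - {f})). not_enclosed g"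
        by auto
      moreover have "card (?U - {f}) < card U"
        using fin e f by (intro psubset_card_mono) auto
      ultimately show ?thesis
        using less.hyps[of "?U - {f}" "insert f T"] less.prems fU opt by force
    qed
    then show ?thesis
      using game_value_ge_Isolator_move[OF fin e(1), of ?G T] by linarith
  qed
qed

lemma gaps_open: "gaps a k (replicate m None @ w) = gaps a (k + m) w"
  by (induction m arbitrary: k) auto

lemma u_cycle_graph_lower:
  assumes "3 \<le> n"
  shows "3 * (int n - 3) \<le> 16 * int (u (cycle_graph n))"
proof -
  let ?E = "edges (cycle_graph n)"
  have "finite ?E" "?E \<noteq> {}"
    using assms by (simp_all add: edges_cycle_graph lessThan_empty_iff)
  then obtain e where e: "e \<in> ?E"
    and opt: "u (cycle_graph n) = game_value (cycle_graph n) Isolator {e} (?E - {e})"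
    unfolding u_def using Toucher_has_optimal_move[of ?E "cycle_graph n" "{}"] by blast
  then obtain j where j: "e = cycle_edge n j"
    by (auto simp: edges_cycle_graph)
  have edge: "cycle_edge n (j + Suc i) \<in> ?E" if "i < n" for i
    using bij_betw_cycle_edge[OF assms, of "Suc j"] that by (auto simp: bij_betw_def)
  have e_last: "e = cycle_edge n (j + Suc (n - 1))"
    using assms j cycle_edge_mod[of n "j + n"] cycle_edge_mod[of n j] by simp
  have "word n j {e} (?E - {e}) = (word n j {} ?E)[n - 1 := Some Toucher]"
    using word_claim(1)[OF assms _ e_last, of "{}" ?E] assms by simp
  also have "word n j {} ?E = replicate n None"
    using edge by (auto intro!: nth_equalityI simp: nth_word cell_def)
  also have "(replicate n None)[n - 1 := Some Toucher] = replicate (n - 1) None @ [Some Toucher]"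
    using assms by (auto intro!: nth_equalityI simp: nth_append nth_list_update)
  finally have gaps: "gaps Toucher 0 (word n j {e} (?E - {e})) = [(Toucher, Toucher, n - 1)]"
    by (simp add: gaps_open)
  have "total_worth [(Toucher, Toucher, n - 1)] \<le> 16 * int (u (cycle_graph n))"
    using total_worth_le_game_value[OF assms, of j "{e}" "?E - {e}"] e j gaps opt by auto
  then show ?thesis
    using assms by simp
qed

lemma u_cycle_graph_upper:
  assumes "3 \<le> n"
  shows "real (u (cycle_graph n)) \<le> real n / 4"
proof -
  let ?E = "edges (cycle_graph n)"
  have deg: "free_degree ?E v = 2" if "v < n" for v
  proof -
    \<comment> \<open>The predecessor of \<open>v\<close> on the cycle.\<close>
    define v' where "v' = (if v = 0 then n - 1 else v - 1)"
    have v': "v' < n" "v' \<noteq> v" "Suc v' mod n = v"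
      using that assms by (auto simp: v'_def)
    have "v \<in> cycle_edge n m \<longleftrightarrow> m = v \<or> m = v'" if "m < n" for m
    proof -
      have "Suc m mod n = Suc v' mod n \<longleftrightarrow> m = v'"
        using that v'(1) by (auto simp: mod_Suc)
      then show ?thesis
        using that v'(3) by (auto simp: cycle_edge_def)
    qed
    then have "{e \<in> ?E. v \<in> e} = {cycle_edge n v, cycle_edge n v'}"
      using that v'(1) by (auto simp: edges_cycle_graph)
    moreover have "cycle_edge n v \<noteq> cycle_edge n v'"
      using inj_on_cycle_edge[OF assms] that v' by (auto dest: inj_onD)
    ultimately show ?thesis
      by (simp add: free_degree_def)
  qed
  have "expectation (cycle_graph n) {} ?E = (\<Sum>v<n. (1/2) ^ free_degree ?E v)"
    by (simp add: expectation_def untouched_def verts_def cycle_graph_def lessThan_def)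
  also have "\<dots> = (\<Sum>v<n. 1/4 :: real)"
    using deg by (intro sum.cong) (auto simp: power2_eq_square)
  also have "\<dots> = real n / 4"
    by simp
  finally have "expectation (cycle_graph n) {} ?E = real n / 4" .
  moreover have "finite ?E"
    by (simp add: edges_cycle_graph)
  moreover have "finite (verts (cycle_graph n))"
    by (simp add: verts_def cycle_graph_def)
  ultimately show ?thesis
    unfolding u_def using game_value_le_expectation[of "cycle_graph n" ?E "{}"] by simp
qed

theorem theorem1p3:
  fixes n :: nat
  assumes "n \<ge> 3"
  shows "3 / 16 * (real n - 3) \<le> real (u (cycle_graph n)) \<and>
         real (u (cycle_graph n)) \<le> real n / 4"
proof
  have "real_of_int (3 * (int n - 3)) \<le> real_of_int (16 * int (u (cycle_graph n)))"
    using u_cycle_graph_lower[OF assms] by (simp only: of_int_le_iff)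
  then show "3 / 16 * (real n - 3) \<le> real (u (cycle_graph n))"
    by simp
  show "real (u (cycle_graph n)) \<le> real n / 4"
    by (rule u_cycle_graph_upper[OF assms])
qed

end
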